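(* A vector of power demands $\tilde P_c\in\mathbb R^n$ is feasible (i.e., $\tilde P_c\in\mathcal F$) if $$\big(\tfrac14[V_L^*]Y_{LL}[V_L^*]\big)^{-1}\,\mathbf{max}(\tilde P_c,\mathbf 0)\le\mathbf 1 .\qquad( * )$$ Moreover, a vector $\tilde P_c$ satisfying $( * )$ is feasible under small perturbation (i.e., $\tilde P_c\in\operatorname{int}(\mathcal F)$) if there is no nonempty $\alpha\subseteq\{1,\dots,n\}$ for which $\tilde P_c$ is of the form $$(\tilde P_c)_{[\alpha]}=\tfrac14\,[(V_L^* )_{[\alpha]}]\,\big(Y_{LL}/(Y_{LL})_{[\alpha^c,\alpha^c]}\big)\,(V_L^* )_{[\alpha]},\qquad (\tilde P_c)_{[\alpha^c]}=\mathbf 0 .$$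
   Context: Notation: $[x]=\operatorname{diag}(x_1,\dots,x_k)$ for a vector $x$; $\mathbf 1,\mathbf 0$ are the all-ones and all-zeros vectors; vector inequalities are element-wise; $\mathbf{max}(a,b)$ is the element-wise maximum of $a,b\in\mathbb R^n$. For $\alpha,\beta\subseteq\{1,\dots,n\}$, $A_{[\alpha,\beta]}$ is the submatrix of $A$ with rows indexed by $\alpha$ and columns indexed by $\beta$, $v_{[\alpha]}$ is the corresponding subvector of $v$, and $\alpha^c=\{1,\dots,n\}\setminus\alpha$. The expression $Y_{LL}/(Y_{LL})_{[\alpha^c,\alpha^c]}$ is the Schur complement $(Y_{LL})_{[\alpha,\alpha]}-(Y_{LL})_{[\alpha,\alpha^c]}\big((Y_{LL})_{[\alpha^c,\alpha^c]}\big)^{-1}(Y_{LL})_{[\alpha^c,\alpha]}$ (equal to $Y_{LL}$ when $\alpha=\{1,\dots,n\}$). Setting: a DC power grid with $n\ge1$ loads and $m\ge1$ sources. Its Kirchhoff matrix $Y=\begin{pmatrix} Y_{LL} & Y_{LS} \\ Y_{SL} & Y_{SS} \end{pmatrix}\in\mathbb R^{(n+m)\times(n+m)}$ is the weighted Laplacian of a connected undirected graph with positive edge weights (symmetric, nonpositive off-diagonal entries, zero row sums), partitioned according to loads and sources, and the $n\times n$ matrix $Y_{LL}$ is irreducible; hence $Y_{LL}$ is symmetric positive definite with nonpositive off-diagonal entries. The source voltages $V_S\in\mathbb R^m$, $V_S>\mathbf 0$, are fixed. Put $\mathcal I_L^*=-Y_{LS}V_S$ (which satisfies $\mathcal I_L^*\ge\mathbf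 0$, $\mathcal I_L^*\ne\mathbf 0$) and $V_L^*=Y_{LL}^{-1}\mathcal I_L^*$ (which satisfies $V_L^*>\mathbf 0$). For $V_L\in\mathbb R^n$ put $P_c(V_L)=[V_L]Y_{LL}(V_L^*-V_L)$. The set of feasible power demands is $\mathcal F=\{P_c(V_L): V_L\in\mathbb R^n,\ V_L>\mathbf 0\}$, with interior $\operatorname{int}(\mathcal F)$ in $\mathbb R^n$. *)

theory Defs
  imports "HOL-Analysis.Analysis"
begin

definition diag_mat :: "real ^ 'k \<Rightarrow> real ^ 'k ^ 'k" where
  "diag_mat x = (\<chi> i j. if i = j then x $ i else 0)"

definition vec_max :: "real ^ 'k \<Rightarrow> real ^ 'k \<Rightarrow> real ^ 'k" where
  "vec_max a b = (\<chi> i. max (a $ i) (b $ i))"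

text \<open>
  On \<open>real ^ 'k\<close> the library order \<open>\<le>\<close> is element-wise, but the library \<open><\<close> is not
  (it means \<open>\<le>\<close> and different), so the element-wise strict order against zero gets its own name.
\<close>

definition vec_pos :: "real ^ 'k \<Rightarrow> bool" where
  "vec_pos x \<longleftrightarrow> (\<forall>i. 0 < x $ i)"

text \<open>
  Submatrices and subvectors keep the full index type and are filled up with zeros outside the
  selected rows and columns. Sums, products and equality of such padded submatrices with matching
  index sets are exactly those of the submatrices themselves. The inverse of a principal submatrix
  is therefore the padded matrix that is a two-sided inverse relative to the padded identity; it
  is unique whenever it exists, and for the empty index set it is the zero matrix.
\<close>

definition subvec :: "'k set \<Rightarrow> real ^ 'k \<Rightarrow> real ^ 'k" where
  "subvec \<alpha> v = (\<chi> i. if i \<in> \<alpha> then v $ i else 0)"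

definition submat :: "'k set \<Rightarrow> 'k set \<Rightarrow> real ^ 'k ^ 'k \<Rightarrow> real ^ 'k ^ 'k" where
  "submat \<alpha> \<beta> A = (\<chi> i j. if i \<in> \<alpha> \<and> j \<in> \<beta> then A $ i $ j else 0)"

definition submat_inv :: "'k set \<Rightarrow> real ^ 'k ^ 'k \<Rightarrow> real ^ 'k ^ 'k" where
  "submat_inv \<beta> A = (THE B. submat \<beta> \<beta> B = B
     \<and> submat \<beta> \<beta> A ** B = submat \<beta> \<beta> (mat 1)
     \<and> B ** submat \<beta> \<beta> A = submat \<beta> \<beta> (mat 1))"

lemma submat_inv_eqI:
  fixes A B :: "real ^ 'k ^ 'k"
  assumes "submat \<beta> \<beta> B = B"
    and "submat \<beta> \<beta> A ** B = submat \<beta> \<beta> (mat 1)"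
    and "B ** submat \<beta> \<beta> A = submat \<beta> \<beta> (mat 1)"
  shows "submat_inv \<beta> A = B"
proof -
  let ?E = "submat \<beta> \<beta> (mat 1) :: real ^ 'k ^ 'k"
  have E: "?E ** C = C" "C ** ?E = C" if "submat \<beta> \<beta> C = C" for C :: "real ^ 'k ^ 'k"
  proof -
    have c: "C $ i $ j = 0" if "i \<notin> \<beta> \<or> j \<notin> \<beta>" for i j
      by (subst \<open>submat \<beta> \<beta> C = C\<close>[symmetric]) (use that in \<open>auto simp: submat_def\<close>)
    have e: "?E $ i $ k = (if i = k then (if i \<in> \<beta> then 1 else 0) else 0)" for i k
      by (auto simp: submat_def mat_def)
    show "?E ** C = C"
      unfolding vec_eq_iff matrix_matrix_mult_def
      by (auto simp: e c if_distrib[of "\<lambda>x. x * _"] cong: if_cong)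
    show "C ** ?E = C"
      unfolding vec_eq_iff matrix_matrix_mult_def
      by (auto simp: e c if_distrib[of "\<lambda>x. _ * x"] cong: if_cong)
  qed
  show ?thesis
    unfolding submat_inv_def
  proof (rule the_equality)
    fix C :: "real ^ 'k ^ 'k"
    assume C: "submat \<beta> \<beta> C = C \<and> submat \<beta> \<beta> A ** C = ?E \<and> C ** submat \<beta> \<beta> A = ?E"
    then have "C = C ** (submat \<beta> \<beta> A ** B)"
      using assms(2) E(2)[of C] by simp
    also have "\<dots> = B"
      using C E(1)[OF assms(1)] by (simp add: matrix_mul_assoc)
    finally show "C = B" .
  qed (use assms in blast)
qed

text \<open>The Schur complement \<open>A / A\<^bsub>[\<alpha>\<^sup>c,\<alpha>\<^sup>c]\<^esub>\<close>, a matrix on the index set \<open>\<alpha>\<close>.\<close>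

definition schur_complement :: "real ^ 'k ^ 'k \<Rightarrow> 'k set \<Rightarrow> real ^ 'k ^ 'k" where
  "schur_complement A \<alpha> =
     submat \<alpha> \<alpha> A - submat \<alpha> (- \<alpha>) A ** submat_inv (- \<alpha>) A ** submat (- \<alpha>) \<alpha> A"

text \<open>
  Reducible means that a simultaneous permutation of rows and columns brings the matrix into block
  triangular form with nonempty diagonal blocks; the set \<open>S\<close> indexes one of the blocks.
  Matrices of size one are irreducible under this convention.
\<close>

definition irreducible_mat :: "real ^ 'k ^ 'k \<Rightarrow> bool" where
  "irreducible_mat A \<longleftrightarrow>
     \<not> (\<exists>S. S \<noteq> {} \<and> S \<noteq> UNIV \<and> (\<forall>i\<in>S. \<forall>j\<in>- S. A $ i $ j = 0))"

definition weighted_laplacian :: "('k \<times> 'k) set \<Rightarrow> ('k \<Rightarrow> 'k \<Rightarrow> real) \<Rightarrow> real ^ 'k ^ 'k" where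
  "weighted_laplacian E w =
     (\<chi> i j. if i = j then (\<Sum>k | (i, k) \<in> E. w i k) else if (i, j) \<in> E then - w i j else 0)"

definition kirchhoff_matrix :: "real ^ 'k ^ 'k \<Rightarrow> bool" where
  "kirchhoff_matrix Y \<longleftrightarrow>
     (\<exists>E w. sym E \<and> irrefl E \<and> (\<forall>i j. (i, j) \<in> E\<^sup>*)
        \<and> (\<forall>(i, j)\<in>E. 0 < w i j \<and> w i j = w j i)
        \<and> Y = weighted_laplacian E w)"

text \<open>
  The nodes of a power grid are the elements of \<open>'n + 'm\<close>: loads are \<open>Inl i\<close>, sources are \<open>Inr j\<close>.
  Both index types are nonempty, so there is at least one load and at least one source.
\<close>

definition Y_LL :: "real ^ ('n::finite + 'm::finite) ^ ('n + 'm) \<Rightarrow> real ^ 'n ^ 'n" where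
  "Y_LL Y = (\<chi> i j. Y $ Inl i $ Inl j)"

definition Y_LS :: "real ^ ('n::finite + 'm::finite) ^ ('n + 'm) \<Rightarrow> real ^ 'm ^ 'n" where
  "Y_LS Y = (\<chi> i j. Y $ Inl i $ Inr j)"

definition I_L_star :: "real ^ ('n::finite + 'm::finite) ^ ('n + 'm) \<Rightarrow> real ^ 'm \<Rightarrow> real ^ 'n" where
  "I_L_star Y V_S = - (Y_LS Y *v V_S)"

definition V_L_star :: "real ^ ('n::finite + 'm::finite) ^ ('n + 'm) \<Rightarrow> real ^ 'm \<Rightarrow> real ^ 'n" where
  "V_L_star Y V_S = matrix_inv (Y_LL Y) *v I_L_star Y V_S"

definition power_demand ::
    "real ^ ('n::finite + 'm::finite) ^ ('n + 'm) \<Rightarrow> real ^ 'm \<Rightarrow> real ^ 'n \<Rightarrow> real ^ 'n" where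
  "power_demand Y V_S V_L = diag_mat V_L *v (Y_LL Y *v (V_L_star Y V_S - V_L))"

definition feasible_demands ::
    "real ^ ('n::finite + 'm::finite) ^ ('n + 'm) \<Rightarrow> real ^ 'm \<Rightarrow> (real ^ 'n) set" where
  "feasible_demands Y V_S = {power_demand Y V_S V_L | V_L. vec_pos V_L}"

text \<open>The inequality \<open>((1/4) [V\<^sub>L\<^sup>*] Y\<^sub>L\<^sub>L [V\<^sub>L\<^sup>*])\<^sup>-\<^sup>1 max(P, 0) \<le> 1\<close>.\<close>

definition demand_bound ::
    "real ^ ('n::finite + 'm::finite) ^ ('n + 'm) \<Rightarrow> real ^ 'm \<Rightarrow> real ^ 'n \<Rightarrow> bool" where
  "demand_bound Y V_S P \<longleftrightarrow>
     matrix_inv ((1/4) *\<^sub>R (diag_mat (V_L_star Y V_S) ** Y_LL Y ** diag_mat (V_L_star Y V_S)))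
       *v vec_max P 0 \<le> 1"

definition critical_form ::
    "real ^ ('n::finite + 'm::finite) ^ ('n + 'm) \<Rightarrow> real ^ 'm \<Rightarrow> 'n set \<Rightarrow> real ^ 'n \<Rightarrow> bool" where
  "critical_form Y V_S \<alpha> P \<longleftrightarrow>
     subvec \<alpha> P = (1/4) *\<^sub>R (diag_mat (subvec \<alpha> (V_L_star Y V_S))
       *v (schur_complement (Y_LL Y) \<alpha> *v subvec \<alpha> (V_L_star Y V_S)))
     \<and> subvec (- \<alpha>) P = 0"

end

theory Submission
  imports Defs
begin

text \<open>
  Write \<open>A = Y\<^sub>L\<^sub>L\<close>, \<open>v = V\<^sub>L\<^sup>*\<close> and \<open>p(V) = [V] A (v - V)\<close>. Since the off-diagonal entries of \<open>A\<close>
  are nonpositive, \<open>V \<mapsto> A (v - V) - P / V\<close> is quasimonotone, so it has a zero between any sub- and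
  supersolution. Large multiples of \<open>A\<^sup>-\<^sup>1 1 > 0\<close> give supersolutions, hence \<open>P\<close> is feasible iff
  \<open>P \<le> p(V)\<close> for some \<open>V > 0\<close>, and \<open>P < p(V)\<close> everywhere puts \<open>P\<close> into the interior.

  If \<open>[v] A y = max(P, 0)\<close>, then condition \<open>(*)\<close> says \<open>4 y \<le> v\<close>, and \<open>V = v - 2 y \<ge> v / 2\<close> is a
  subsolution. It can be made strict as soon as it has slack at one index \<open>k\<close>, that is, \<open>P\<^sub>k < 0\<close>, or
  \<open>P\<^sub>k > 0\<close> and \<open>4 y\<^sub>k < v\<^sub>k\<close>. Without slack, \<open>P \<ge> 0\<close> and \<open>4 y = v\<close> on the support \<open>\<alpha>\<close> of \<open>P\<close>;
  eliminating the entries of \<open>y\<close> off \<open>\<alpha>\<close> then yields the critical form.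
\<close>

section \<open>Zeros of quasimonotone maps between a sub- and a supersolution\<close>

lemma quasimonotone_zero_in_cbox:
  fixes f :: "real ^ 'n \<Rightarrow> real ^ 'n"
  assumes cont: "continuous_on (cbox a b) f"
    and ab: "a \<le> b"
    and qm: "\<And>x y i. x \<in> cbox a b \<Longrightarrow> y \<in> cbox a b \<Longrightarrow> x \<le> y \<Longrightarrow> x $ i = y $ i \<Longrightarrow> f x $ i \<le> f y $ i"
    and sub: "0 \<le> f a" and super: "f b \<le> 0"
  shows "\<exists>x\<in>cbox a b. f x = 0"
proof -
  text \<open>A fixed point of the clipped map is a zero of \<open>f\<close>: by quasimonotonicity, \<open>f\<close> points inwards on the faces.\<close>
  define g where "g x = (\<chi> i. max (a $ i) (min (b $ i) (x $ i + f x $ i)))" for x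
  have "continuous_on (cbox a b) g"
    unfolding g_def by (intro continuous_intros cont)
  moreover have "g \<in> cbox a b \<rightarrow> cbox a b"
    using ab by (auto simp: g_def mem_box_cart less_eq_vec_def)
  moreover have mem: "a \<in> cbox a b" "b \<in> cbox a b"
    using ab by (auto simp: mem_box_cart less_eq_vec_def)
  ultimately obtain x where x: "x \<in> cbox a b" "g x = x"
    using brouwer[of "cbox a b" g] by (auto simp: compact_cbox convex_box)
  have ax: "a \<le> x" and xb: "x \<le> b"
    using x(1) by (auto simp: mem_box_cart less_eq_vec_def)
  have "f x $ i = 0" for i
  proof -
    have gx: "max (a $ i) (min (b $ i) (x $ i + f x $ i)) = x $ i"
      using x(2) by (auto simp: g_def vec_eq_iff)
    have "0 \<le> f x $ i" if "x $ i = a $ i"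
      using qm[OF mem(1) x(1) ax, of i] sub that by (auto simp: less_eq_vec_def intro: order_trans)
    moreover have "f x $ i \<le> 0" if "x $ i = b $ i"
      using qm[OF x(1) mem(2) xb, of i] super that by (auto simp: less_eq_vec_def intro: order_trans)
    moreover have "a $ i \<le> x $ i" "x $ i \<le> b $ i"
      using ax xb by (auto simp: less_eq_vec_def)
    ultimately show ?thesis
      using gx by (auto simp: max_def min_def split: if_splits)
  qed
  then show ?thesis
    using x(1) by (auto simp: vec_eq_iff)
qed

text \<open>Finitely many strict inequalities that hold at \<open>\<epsilon> = 0\<close> survive for
  small positive \<open>\<epsilon>\<close>, whatever the signs in \<open>h\<close>.\<close>

lemma small_multiple_below:
  fixes v h :: "real ^ 'n"
  assumes "vec_pos v"
  shows "\<exists>\<epsilon>>0. \<forall>i. \<epsilon> * h $ i < v $ i"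
proof -
  have "\<forall>\<^sub>F \<epsilon> in at_right 0. \<epsilon> * h $ i < v $ i" for i
  proof (rule order_tendstoD(2))
    show "((\<lambda>\<epsilon>. \<epsilon> * h $ i) \<longlongrightarrow> 0) (at_right 0)"
      by (auto intro!: tendsto_eq_intros)
  qed (use assms in \<open>simp add: vec_pos_def\<close>)
  then have "\<forall>\<^sub>F \<epsilon> in at_right 0. \<forall>i. \<epsilon> * h $ i < v $ i"
    by (simp add: eventually_all_finite)
  then have "\<forall>\<^sub>F \<epsilon> in at_right 0. 0 < \<epsilon> \<and> (\<forall>i. \<epsilon> * h $ i < v $ i)"
    using eventually_at_right_less[of 0] by eventually_elim auto
  then show ?thesis
    by (auto dest: eventually_happens)
qed

section \<open>Matrices with a strong minimum principle\<close>

text \<open>An abstract irreducible nonsingular M-matrix: the minimum principle combines a trivial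
  kernel with an entrywise positive inverse, and the sign condition yields
  quasimonotonicity.\<close>

locale strong_M_matrix =
  fixes A :: "real ^ 'n ^ 'n"
  assumes off_diag: "i \<noteq> j \<Longrightarrow> A $ i $ j \<le> 0"
    and strong_min_principle: "0 \<le> A *v x \<Longrightarrow> x = 0 \<or> vec_pos x"
begin

text \<open>In row \<open>i\<close> only off-diagonal terms can differ, and their coefficients are
  nonpositive.\<close>

lemma mult_quasimonotone:
  assumes "x \<le> y" "x $ i = y $ i"
  shows "(A *v y) $ i \<le> (A *v x) $ i"
proof -
  have "A $ i $ j * y $ j \<le> A $ i $ j * x $ j" for j
    using assms off_diag[of i j]
    by (cases "i = j") (auto simp: less_eq_vec_def mult_left_mono_neg)
  then show ?thesis
    unfolding matrix_vector_mult_def by (auto intro: sum_mono)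
qed

lemma mult_eq_0_imp: "A *v x = 0 \<Longrightarrow> x = 0"
  using strong_min_principle[of x] strong_min_principle[of "- x"]
  by (force simp: vec_pos_def vec.neg dest: less_asym)

lemma invertible_A: "invertible A"
  using mult_eq_0_imp by (auto simp: invertible_left_inverse matrix_left_invertible_ker)

lemma solution: obtains x where "A *v x = b"
  using invertible_A by (metis invertible_right_inverse matrix_right_invertible_surjective surjD)

lemma solution_pos:
  assumes "A *v x = b" "0 \<le> b" "b \<noteq> 0"
  shows "vec_pos x"
  using strong_min_principle[of x] assms by auto

lemma solution_one: obtains h where "A *v h = 1" "\<And>i. 0 < h $ i"
proof -
  obtain h where h: "A *v h = 1"
    using solution by blast
  from solution_pos[OF this] have "0 < h $ i" for i
    by (auto simp: vec_pos_def less_eq_vec_def vec_eq_iff)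
  with h show ?thesis
    by (rule that)
qed

lemma solution_of_subsolution:
  assumes x: "vec_pos x" and P: "\<And>i. P $ i \<le> x $ i * (A *v (v - x)) $ i"
  shows "\<exists>V. vec_pos V \<and> (\<forall>i. V $ i * (A *v (v - V)) $ i = P $ i)"
proof -
  obtain h where h: "A *v h = 1" and hpos: "\<And>i. 0 < h $ i"
    using solution_one by blast
  have xpos: "0 < x $ i" for i
    using x by (simp add: vec_pos_def)
  \<comment> \<open>For \<open>M = x + K h\<close>, the vector \<open>A *v (v - M)\<close> is
    \<open>A *v (v - x)\<close> lowered by \<open>K\<close> in every entry. The sum over all indices
    dominates each summand, so every entry drops to at most
    \<open>- \<bar>P $ i\<bar> / x $ i\<close> and \<open>M\<close> is a supersolution.\<close>
  define K where "K = (\<Sum>i\<in>UNIV. \<bar>(A *v (v - x)) $ i\<bar> + \<bar>P $ i\<bar> / x $ i)"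
  have K: "\<bar>(A *v (v - x)) $ i\<bar> + \<bar>P $ i\<bar> / x $ i \<le> K" for i
    unfolding K_def using xpos
    by (intro member_le_sum) (auto intro!: add_nonneg_nonneg divide_nonneg_pos)
  have K0: "0 \<le> K"
    unfolding K_def using xpos by (auto intro!: sum_nonneg add_nonneg_nonneg divide_nonneg_pos)
  define M where "M = x + K *\<^sub>R h"
  define f where "f V = (\<chi> i. (A *v (v - V)) $ i - P $ i / V $ i)" for V :: "real ^ 'n"
  have pos: "0 < V $ i" if "V \<in> cbox x M" for V i
    using that xpos[of i] by (auto simp: mem_box_cart intro: less_le_trans)
  have "x \<le> M"
    using K0 hpos by (simp add: M_def less_eq_vec_def less_imp_le)
  moreover have "continuous_on (cbox x M) f"
    unfolding f_def matrix_vector_mult_def using pos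
    by (auto intro!: continuous_intros simp: less_imp_neq[symmetric])
  moreover have "f V $ i \<le> f W $ i" if "V \<le> W" "V $ i = W $ i" for V W i
    using mult_quasimonotone[OF that] that
    by (simp add: f_def matrix_vector_mult_diff_distrib)
  moreover have "0 \<le> f x"
    using P xpos by (auto simp: f_def less_eq_vec_def field_simps)
  moreover have "f M \<le> 0"
  proof -
    have "(A *v (v - M)) $ i \<le> P $ i / M $ i" for i
    proof -
      have "A *v (v - M) = A *v (v - x) - K *\<^sub>R 1"
        by (simp add: M_def matrix_vector_mult_diff_distrib matrix_vector_right_distrib
            matrix_vector_mult_scaleR h)
      then have "(A *v (v - M)) $ i = (A *v (v - x)) $ i - K"
        by simp
      also have "\<dots> \<le> - (\<bar>P $ i\<bar> / x $ i)"
        using K[of i] by linarith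
      also have "\<dots> \<le> - (\<bar>P $ i\<bar> / M $ i)"
        using \<open>x \<le> M\<close> xpos[of i]
        by (auto simp: less_eq_vec_def intro!: divide_left_mono mult_pos_pos intro: less_le_trans)
      also have "\<dots> \<le> P $ i / M $ i"
        using pos[of M i] \<open>x \<le> M\<close>
        by (auto simp: mem_box_cart less_eq_vec_def divide_simps)
      finally show ?thesis .
    qed
    then show ?thesis
      by (auto simp: f_def less_eq_vec_def)
  qed
  ultimately obtain V where V: "V \<in> cbox x M" "f V = 0"
    using quasimonotone_zero_in_cbox[of x M f] by blast
  have "V $ i * (A *v (v - V)) $ i = P $ i" for i
    using V(2) pos[OF V(1), of i] by (auto simp: f_def vec_eq_iff field_simps)
  then show ?thesis
    using pos[OF V(1)] by (auto simp: vec_pos_def)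
qed

lemma subsolution_pos:
  assumes "\<And>i. 4 * y $ i \<le> v $ i" "vec_pos v"
  shows "vec_pos (v - 2 *\<^sub>R y)"
proof -
  have "0 < v $ i - 2 * y $ i" for i
    using assms(1)[of i] assms(2)[unfolded vec_pos_def, rule_format, of i] by linarith
  then show ?thesis
    by (simp add: vec_pos_def)
qed

text \<open>At \<open>V = v - 2 y\<close> the power is
  \<open>V $ i * (2 * max (P $ i) 0 / v $ i)\<close>, and \<open>4 y \<le> v\<close> makes the first
  factor at least \<open>v $ i / 2\<close>.\<close>

lemma subsolution:
  assumes v: "vec_pos v" and y: "\<And>i. v $ i * (A *v y) $ i = max (P $ i) 0" "\<And>i. 4 * y $ i \<le> v $ i"
  shows "P $ i \<le> (v - 2 *\<^sub>R y) $ i * (A *v (v - (v - 2 *\<^sub>R y))) $ i"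
proof -
  have vi: "0 < v $ i"
    using v by (simp add: vec_pos_def)
  have Ay: "(A *v y) $ i = max (P $ i) 0 / v $ i"
    using y(1)[of i] vi by (simp add: field_simps)
  have "max (P $ i) 0 = (v $ i / 2) * (2 * (max (P $ i) 0 / v $ i))"
    using vi by simp
  also have "\<dots> \<le> (v $ i - 2 * y $ i) * (2 * (max (P $ i) 0 / v $ i))"
    using y(2)[of i] vi by (intro mult_right_mono) auto
  finally show ?thesis
    by (simp add: matrix_vector_mult_scaleR Ay)
qed

text \<open>
  Moving from \<open>v - 2 y\<close> in the direction \<open>q = A\<^sup>-\<^sup>1 (e\<^sub>k - \<eta> 1)\<close>, which is positive because
  \<open>A\<^sup>-\<^sup>1\<close> is entrywise positive, gains power at every index except \<open>k\<close>, where there is slack.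
\<close>

lemma strict_subsolution:
  assumes v: "vec_pos v" and y: "\<And>i. v $ i * (A *v y) $ i = max (P $ i) 0" "\<And>i. 4 * y $ i \<le> v $ i"
    and slack: "P $ k < 0 \<or> 0 < P $ k \<and> 4 * y $ k < v $ k"
  shows "\<exists>V. vec_pos V \<and> (\<forall>i. P $ i < V $ i * (A *v (v - V)) $ i)"
proof -
  have vpos: "0 < v $ i" for i
    using v by (simp add: vec_pos_def)
  have Ay: "(A *v y) $ i = max (P $ i) 0 / v $ i" for i
    using y(1)[of i] vpos[of i] by (simp add: field_simps)
  obtain g where g: "A *v g = axis k 1"
    using solution by blast
  have gpos: "0 < g $ i" for i
    using solution_pos[OF g] by (auto simp: vec_pos_def less_eq_vec_def vec_eq_iff axis_def)
  obtain h where h: "A *v h = 1"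
    using solution by blast
  obtain \<eta> where \<eta>: "0 < \<eta>" "\<And>i. \<eta> * h $ i < g $ i"
    using small_multiple_below[of g h] gpos by (auto simp: vec_pos_def)
  define q where "q = g - \<eta> *\<^sub>R h"
  have q: "0 < q $ i" for i
    using \<eta>(2)[of i] by (simp add: q_def)
  \<comment> \<open>This is the power at \<open>k\<close> after the move by
    \<open>\<epsilon> q\<close>: as \<open>A *v q\<close> has the entry \<open>1 - \<eta>\<close>
    there, the second factor loses \<open>\<epsilon> - \<epsilon> * \<eta>\<close>.\<close>
  have "((\<lambda>\<epsilon>. (v $ k - 2 * y $ k + \<epsilon> * q $ k) * (2 * (max (P $ k) 0 / v $ k) + (\<epsilon> * \<eta> - \<epsilon>)))
      \<longlongrightarrow> (v $ k - 2 * y $ k) * (2 * (max (P $ k) 0 / v $ k))) (at_right 0)"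
    by (auto intro!: tendsto_eq_intros)
  \<comment> \<open>If \<open>P $ k < 0\<close>, the right-hand side is zero; otherwise slack puts
    the first factor strictly above \<open>v $ k / 2\<close>.\<close>
  moreover have "P $ k < (v $ k - 2 * y $ k) * (2 * (max (P $ k) 0 / v $ k))"
    using slack
  proof
    assume k: "0 < P $ k \<and> 4 * y $ k < v $ k"
    then have "P $ k = (v $ k / 2) * (2 * (P $ k / v $ k))"
      using vpos[of k] by simp
    also have "\<dots> < (v $ k - 2 * y $ k) * (2 * (P $ k / v $ k))"
      using k vpos[of k] by (intro mult_strict_right_mono) auto
    finally show ?thesis
      using k by simp
  qed (simp add: max_def)
  ultimately have "\<forall>\<^sub>F \<epsilon> in at_right 0. P $ k <
      (v $ k - 2 * y $ k + \<epsilon> * q $ k) * (2 * (max (P $ k) 0 / v $ k) + (\<epsilon> * \<eta> - \<epsilon>))"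
    by (rule order_tendstoD(1))
  then have "\<forall>\<^sub>F \<epsilon> in at_right 0. 0 < \<epsilon> \<and> P $ k <
      (v $ k - 2 * y $ k + \<epsilon> * q $ k) * (2 * (max (P $ k) 0 / v $ k) + (\<epsilon> * \<eta> - \<epsilon>))"
    using eventually_at_right_less[of 0] by eventually_elim auto
  then obtain \<epsilon> where \<epsilon>: "0 < \<epsilon>" and at_k: "P $ k <
      (v $ k - 2 * y $ k + \<epsilon> * q $ k) * (2 * (max (P $ k) 0 / v $ k) + (\<epsilon> * \<eta> - \<epsilon>))"
    by (auto dest: eventually_happens)
  define V where "V = v - 2 *\<^sub>R y + \<epsilon> *\<^sub>R q"
  have half: "v $ i / 2 < V $ i" for i
    using y(2)[of i] mult_pos_pos[OF \<epsilon> q[of i]] by (simp add: V_def)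
  have "v - V = 2 *\<^sub>R y - \<epsilon> *\<^sub>R g + (\<epsilon> * \<eta>) *\<^sub>R h"
    by (simp add: V_def q_def algebra_simps)
  then have AV: "A *v (v - V) = 2 *\<^sub>R (A *v y) - \<epsilon> *\<^sub>R axis k 1 + (\<epsilon> * \<eta>) *\<^sub>R 1"
    by (simp add: matrix_vector_mult_diff_distrib matrix_vector_right_distrib
        matrix_vector_mult_scaleR g h)
  have "P $ i < V $ i * (A *v (v - V)) $ i" for i
  proof (cases "i = k")
    case True
    then show ?thesis
      using at_k unfolding AV by (simp add: Ay V_def axis_def add_diff_eq diff_add_eq)
  next
    case False
    have "max (P $ i) 0 = (v $ i / 2) * (2 * (max (P $ i) 0 / v $ i))"
      using vpos[of i] by simp
    also have "\<dots> \<le> V $ i * (2 * (max (P $ i) 0 / v $ i))"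
      using half[of i] vpos[of i] by (intro mult_right_mono) auto
    also have "\<dots> < V $ i * (2 * (max (P $ i) 0 / v $ i) + \<epsilon> * \<eta>)"
      using half[of i] vpos[of i] \<epsilon> \<eta>(1) by (intro mult_strict_left_mono) auto
    finally show ?thesis
      using False by (simp add: AV Ay axis_def)
  qed
  moreover have "0 < V $ i" for i
    using half[of i] vpos[of i] by linarith
  ultimately show ?thesis
    by (auto simp: vec_pos_def)
qed

text \<open>Zero demand has no index with slack. Strictness comes instead from
  \<open>V = v - \<epsilon> h\<close> with \<open>A *v h = 1\<close>, where every entry of
  \<open>A *v (v - V)\<close> is \<open>\<epsilon>\<close>.\<close>

lemma strict_subsolution_zero_demand:
  assumes "vec_pos v"
  shows "\<exists>V. vec_pos V \<and> (\<forall>i. 0 < V $ i * (A *v (v - V)) $ i)"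
proof -
  obtain h where h: "A *v h = 1"
    using solution by blast
  obtain \<epsilon> where "0 < \<epsilon>" "\<And>i. \<epsilon> * h $ i < v $ i"
    using small_multiple_below[OF assms] by blast
  then show ?thesis
    by (intro exI[of _ "v - \<epsilon> *\<^sub>R h"]) (auto simp: vec_pos_def matrix_vector_mult_scaleR h)
qed

section \<open>Principal submatrices and Schur complements\<close>

text \<open>Compare \<open>x\<close> with the least multiple \<open>t h\<close> above it, where
  \<open>A *v h = 1\<close>. If some entry of \<open>x\<close> were positive, then
  \<open>t > 0\<close> and contact would occur at some \<open>k\<close> in \<open>\<beta>\<close>;
  there \<open>A *v (t h - x)\<close> has the entry \<open>t\<close>, which quasimonotonicity forces
  to be nonpositive.\<close>

lemma principal_nonpos:
  assumes x: "subvec \<beta> x = x" "subvec \<beta> (A *v x) = 0"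
  shows "x $ i \<le> 0"
proof (rule ccontr)
  assume i: "\<not> x $ i \<le> 0"
  obtain h where h: "A *v h = 1" and hpos: "\<And>i. 0 < h $ i"
    using solution_one by blast
  define t where "t = Max (range (\<lambda>i. x $ i / h $ i))"
  have t: "x $ i / h $ i \<le> t" for i
    unfolding t_def by (rule Max_ge) auto
  have "t \<in> range (\<lambda>i. x $ i / h $ i)"
    unfolding t_def by (rule Max_in) auto
  then obtain k where k: "t = x $ k / h $ k"
    by blast
  have "0 < x $ i / h $ i"
    using i hpos[of i] by simp
  then have tpos: "0 < t"
    using t[of i] by linarith
  then have "x $ k \<noteq> 0"
    using k by auto
  then have "k \<in> \<beta>"
    using arg_cong[OF x(1), of "\<lambda>x. x $ k"] by (auto simp: subvec_def split: if_splits)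
  then have Axk: "(A *v x) $ k = 0"
    using arg_cong[OF x(2), of "\<lambda>x. x $ k"] by (auto simp: subvec_def)
  have "(A *v (t *\<^sub>R h - x)) $ k \<le> (A *v 0) $ k"
  proof (rule mult_quasimonotone)
    show "0 \<le> t *\<^sub>R h - x"
      using t hpos by (simp add: less_eq_vec_def pos_divide_le_eq)
    show "0 $ k = (t *\<^sub>R h - x) $ k"
      using hpos[of k] by (simp add: k)
  qed
  then show False
    using tpos by (simp add: matrix_vector_mult_diff_distrib matrix_vector_mult_scaleR h Axk)
qed

text \<open>The one-sided bound applies to both \<open>x\<close> and \<open>- x\<close>. This is
  nonsingularity of the principal block on \<open>\<beta>\<close>.\<close>

lemma principal_eq_0:
  assumes "subvec \<beta> x = x" "subvec \<beta> (A *v x) = 0"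
  shows "x = 0"
proof -
  have "subvec \<beta> (- x) = - subvec \<beta> x" "subvec \<beta> (A *v (- x)) = - subvec \<beta> (A *v x)"
    by (auto simp: subvec_def vec_eq_iff vec.neg)
  then have "subvec \<beta> (- x) = - x" "subvec \<beta> (A *v (- x)) = 0"
    using assms by simp_all
  from principal_nonpos[OF assms] principal_nonpos[OF this] show ?thesis
    by (auto simp: vec_eq_iff intro: antisym)
qed

end

lemma subvec_simps [simp]:
  "subvec \<alpha> (subvec \<alpha> x) = subvec \<alpha> x" "subvec (- \<alpha>) (subvec \<alpha> x) = 0"
  "subvec \<alpha> (subvec (- \<alpha>) x) = 0" "subvec \<alpha> 0 = 0"
  by (auto simp: subvec_def vec_eq_iff)

lemma subvec_add: "subvec \<alpha> (x + y) = subvec \<alpha> x + subvec \<alpha> y"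
  by (auto simp: subvec_def vec_eq_iff)

lemma subvec_split: "x = subvec \<alpha> x + subvec (- \<alpha>) x"
  by (auto simp: subvec_def vec_eq_iff)

text \<open>Lets block identities be checked on vectors, as alternating restrictions and
  applications of the full matrix.\<close>

lemma submat_mult: "submat \<alpha> \<beta> A *v x = subvec \<alpha> (A *v subvec \<beta> x)"
  by (auto simp: submat_def subvec_def vec_eq_iff matrix_vector_mult_def intro!: sum.cong)

context strong_M_matrix
begin

lemma submat_inv_inverse:
  "submat_inv \<beta> A ** submat \<beta> \<beta> A = submat \<beta> \<beta> (mat 1)"
proof -
  text \<open>Completing the principal block by an identity block gives an invertible matrix.\<close>
  define C where "C = submat \<beta> \<beta> A + submat (- \<beta>) (- \<beta>) (mat 1)"
  have C: "C *v x = subvec \<beta> (A *v subvec \<beta> x) + subvec (- \<beta>) x" for x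
    by (simp add: C_def matrix_vector_mult_add_rdistrib submat_mult)
  have ker: "x = 0" if "C *v x = 0" for x
  proof -
    have "subvec \<beta> (C *v x) = 0" "subvec (- \<beta>) (C *v x) = 0"
      using that by simp_all
    then have *: "subvec \<beta> (A *v subvec \<beta> x) = 0" "subvec (- \<beta>) x = 0"
      by (simp_all add: C subvec_add)
    then have "subvec \<beta> x = 0"
      using principal_eq_0[of \<beta> "subvec \<beta> x"] by simp
    with * subvec_split[of x \<beta>] show ?thesis
      by simp
  qed
  then have "invertible C"
    by (auto simp: invertible_left_inverse matrix_left_invertible_ker)
  then obtain D where D: "C ** D = mat 1" "D ** C = mat 1"
    by (auto simp: invertible_def)
  have CD: "C *v (D *v x) = x" and DC: "D *v (C *v x) = x" for x
    by (simp_all add: matrix_vector_mul_assoc D)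
  \<comment> \<open>\<open>C\<close> is block diagonal with respect to \<open>\<beta>\<close> and
    its complement, so compressing its inverse to \<open>\<beta>\<close> inverts the principal
    block.\<close>
  define B where "B = submat \<beta> \<beta> D"
  have "subvec \<beta> (D *v subvec \<beta> (A *v subvec \<beta> x)) = subvec \<beta> x" for x
    using arg_cong[OF DC[of "subvec \<beta> x"], of "subvec \<beta>"] unfolding C by simp
  then have BA: "B ** submat \<beta> \<beta> A = submat \<beta> \<beta> (mat 1)"
    by (simp add: matrix_eq B_def submat_mult flip: matrix_vector_mul_assoc)
  have "subvec \<beta> (A *v subvec \<beta> (D *v subvec \<beta> x)) = subvec \<beta> x" for x
    using arg_cong[OF CD[of "subvec \<beta> x"], of "subvec \<beta>"] unfolding C by (simp add: subvec_add)
  then have AB: "submat \<beta> \<beta> A ** B = submat \<beta> \<beta> (mat 1)"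
    by (simp add: matrix_eq B_def submat_mult flip: matrix_vector_mul_assoc)
  have "submat \<beta> \<beta> B = B"
    by (auto simp: B_def submat_def vec_eq_iff)
  then have "submat_inv \<beta> A = B"
    using AB BA by (rule submat_inv_eqI)
  with BA show ?thesis
    by simp
qed

text \<open>Block elimination: the vanishing rows off \<open>\<alpha>\<close> determine the part
  \<open>c\<close> of \<open>y\<close> off \<open>\<alpha>\<close> from its part \<open>a\<close> on
  \<open>\<alpha>\<close>, so the correction term of the Schur complement applied to
  \<open>a\<close> reproduces the contribution of \<open>c\<close>.\<close>

lemma schur_complement_mult:
  assumes "subvec (- \<alpha>) (A *v y) = 0"
  shows "schur_complement A \<alpha> *v subvec \<alpha> y = subvec \<alpha> (A *v y)"
proof -
  define a where "a = subvec \<alpha> y"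
  define c where "c = subvec (- \<alpha>) y"
  have y: "A *v y = A *v a + A *v c"
    using subvec_split[of y \<alpha>] by (simp add: a_def c_def flip: matrix_vector_right_distrib)
  have "submat (- \<alpha>) \<alpha> A *v a = - (submat (- \<alpha>) (- \<alpha>) A *v c)"
    using assms by (simp add: submat_mult y subvec_add a_def c_def eq_neg_iff_add_eq_0)
  then have "submat_inv (- \<alpha>) A *v (submat (- \<alpha>) \<alpha> A *v a)
      = - ((submat_inv (- \<alpha>) A ** submat (- \<alpha>) (- \<alpha>) A) *v c)"
    by (simp add: vec.neg matrix_vector_mul_assoc)
  also have "\<dots> = - c"
    by (simp add: submat_inv_inverse submat_mult c_def)
  finally have "schur_complement A \<alpha> *v a = subvec \<alpha> (A *v a) + subvec \<alpha> (A *v c)"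
    by (simp add: schur_complement_def matrix_vector_mult_diff_rdistrib vec.neg submat_mult
        a_def c_def flip: matrix_vector_mul_assoc)
  then show ?thesis
    by (simp add: y subvec_add a_def)
qed

end

section \<open>Kirchhoff matrices and their load block\<close>

lemma kirchhoff_off_diag: "kirchhoff_matrix Y \<Longrightarrow> i \<noteq> j \<Longrightarrow> Y $ i $ j \<le> 0"
  by (fastforce simp: kirchhoff_matrix_def weighted_laplacian_def)

lemma kirchhoff_row_sum:
  assumes "kirchhoff_matrix Y"
  shows "(\<Sum>j\<in>UNIV. Y $ i $ j) = 0"
proof -
  obtain E w where E: "irrefl E" and Y: "Y = weighted_laplacian E w"
    using assms by (auto simp: kirchhoff_matrix_def)
  have "(\<Sum>j\<in>UNIV. Y $ i $ j) = Y $ i $ i + (\<Sum>j\<in>UNIV - {i}. Y $ i $ j)"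
    by (simp add: sum.remove)
  also have "(\<Sum>j\<in>UNIV - {i}. Y $ i $ j) = (\<Sum>j | (i, j) \<in> E. - w i j)"
    using E by (intro sum.mono_neutral_cong_right) (auto simp: Y weighted_laplacian_def irrefl_def)
  finally show ?thesis
    by (simp add: Y weighted_laplacian_def sum_negf)
qed

text \<open>A path from \<open>a\<close> to \<open>b\<close> must leave \<open>S\<close> along some
  edge, whose entry is minus a positive weight.\<close>

lemma kirchhoff_crossing_edge:
  assumes "kirchhoff_matrix Y" "a \<in> S" "b \<notin> S"
  shows "\<exists>i\<in>S. \<exists>j\<in>- S. Y $ i $ j < 0"
proof -
  obtain E w where E: "(a, b) \<in> E\<^sup>*" "\<forall>(i, j)\<in>E. 0 < w i j \<and> w i j = w j i"
    and Y: "Y = weighted_laplacian E w"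
    using assms(1) by (auto simp: kirchhoff_matrix_def)
  have "b \<in> S \<or> (\<exists>i\<in>S. \<exists>j\<in>- S. (i, j) \<in> E)"
    using E(1) assms(2) by induction auto
  then obtain i j where ij: "i \<in> S" "j \<in> - S" "(i, j) \<in> E"
    using assms(3) by blast
  then have "Y $ i $ j < 0"
    using E(2) by (auto simp: Y weighted_laplacian_def)
  with ij show ?thesis
    by blast
qed

text \<open>Full rows sum to zero. With \<open>Y_LS\<close> nonpositive, the load block thus has
  nonnegative row sums, positive at every load tied to a source.\<close>

lemma Y_LL_row_sum:
  assumes "kirchhoff_matrix Y"
  shows "(\<Sum>j\<in>UNIV. Y_LL Y $ i $ j) = - (\<Sum>k\<in>UNIV. Y_LS Y $ i $ k)"
proof -
  have "(\<Sum>j\<in>UNIV. Y_LL Y $ i $ j) + (\<Sum>k\<in>UNIV. Y_LS Y $ i $ k) = (\<Sum>j\<in>UNIV <+> UNIV. Y $ Inl i $ j)"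
    by (subst sum.Plus) (auto simp: Y_LL_def Y_LS_def)
  then show ?thesis
    using kirchhoff_row_sum[OF assms, of "Inl i"] by simp
qed

lemma Y_LS_nonpos: "kirchhoff_matrix Y \<Longrightarrow> Y_LS Y $ i $ k \<le> 0"
  by (simp add: Y_LS_def kirchhoff_off_diag)

lemma Y_LS_neg_entry:
  assumes "kirchhoff_matrix Y"
  shows "\<exists>i k. Y_LS Y $ i $ k < 0"
proof -
  obtain i k where ik: "i \<in> range Inl" "k \<in> - range Inl" "Y $ i $ k < 0"
    using kirchhoff_crossing_edge[OF assms, of "Inl undefined" "range Inl" "Inr undefined"] by blast
  then obtain i' k' where "i = Inl i'" "k = Inr k'"
    by (cases k) auto
  then show ?thesis
    using ik by (auto simp: Y_LS_def)
qed

text \<open>Let the minimum \<open>m\<close> of \<open>x\<close> be nonpositive. In a row where it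
  is attained, the product is \<open>m\<close> times the row sum plus off-diagonal terms; all are
  nonpositive, hence zero. By irreducibility \<open>x\<close> is constant, and a load tied to a
  source has positive row sum, so \<open>m = 0\<close>.\<close>

lemma strong_M_matrix_Y_LL:
  fixes Y :: "real ^ ('n::finite + 'm::finite) ^ ('n + 'm)"
  assumes Y: "kirchhoff_matrix Y" and irr: "irreducible_mat (Y_LL Y)"
  shows "strong_M_matrix (Y_LL Y)"
proof
  show od: "Y_LL Y $ i $ j \<le> 0" if "i \<noteq> j" for i j
    using that by (simp add: Y_LL_def kirchhoff_off_diag[OF Y])
  fix x :: "real ^ 'n"
  assume Ax: "0 \<le> Y_LL Y *v x"
  define r where "r i = (\<Sum>j\<in>UNIV. Y_LL Y $ i $ j)" for i
  have r: "0 \<le> r i" for i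
    by (simp add: r_def Y_LL_row_sum[OF Y] sum_nonpos Y_LS_nonpos[OF Y])
  define m where "m = Min (range (($) x))"
  have m: "m \<le> x $ i" for i
    unfolding m_def by (rule Min_le) auto
  have "m \<in> range (($) x)"
    unfolding m_def by (rule Min_in) auto
  show "x = 0 \<or> vec_pos x"
  proof (cases "0 < m")
    case True
    then show ?thesis
      using m by (auto simp: vec_pos_def intro: less_le_trans)
  next
    case False
    have eq: "m * r i = 0 \<and> (\<forall>j. Y_LL Y $ i $ j * (x $ j - m) = 0)" if i: "x $ i = m" for i
    proof -
      have "(Y_LL Y *v x) $ i = m * r i + (\<Sum>j\<in>UNIV. Y_LL Y $ i $ j * (x $ j - m))"
        by (simp add: matrix_vector_mult_def r_def sum_distrib_left sum.distrib[symmetric]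
            algebra_simps)
      moreover have neg: "Y_LL Y $ i $ j * (x $ j - m) \<le> 0" for j
        using od[of i j] m[of j] i by (cases "i = j") (auto simp: mult_nonpos_nonneg)
      then have "(\<Sum>j\<in>UNIV. Y_LL Y $ i $ j * (x $ j - m)) \<le> 0"
        by (simp add: sum_nonpos)
      moreover have "m * r i \<le> 0"
        using False r[of i] by (simp add: mult_nonpos_nonneg)
      moreover have "0 \<le> (Y_LL Y *v x) $ i"
        using Ax by (simp add: less_eq_vec_def)
      ultimately have "m * r i = 0" "(\<Sum>j\<in>UNIV. Y_LL Y $ i $ j * (x $ j - m)) = 0"
        by linarith+
      then show ?thesis
        using neg sum_nonneg_eq_0_iff[of UNIV "\<lambda>j. - (Y_LL Y $ i $ j * (x $ j - m))"]
        by (simp add: sum_negf)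
    qed
    define S where "S = {i. x $ i = m}"
    have "S \<noteq> {}"
      using \<open>m \<in> range (($) x)\<close> by (auto simp: S_def)
    moreover have "\<forall>i\<in>S. \<forall>j\<in>- S. Y_LL Y $ i $ j = 0"
      using eq by (fastforce simp: S_def)
    ultimately have "S = UNIV"
      using irr unfolding irreducible_mat_def by meson
    then have const: "x $ i = m" for i
      by (auto simp: S_def set_eq_iff)
    obtain i k where ik: "Y_LS Y $ i $ k < 0"
      using Y_LS_neg_entry[OF Y] by blast
    have "0 < (\<Sum>k\<in>UNIV. - Y_LS Y $ i $ k)"
      using ik Y_LS_nonpos[OF Y] by (intro sum_pos2[of _ k]) auto
    then have "r i \<noteq> 0"
      by (simp add: r_def Y_LL_row_sum[OF Y] sum_negf)
    then have "m = 0"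
      using eq[of i] const by auto
    then show ?thesis
      using const by (simp add: vec_eq_iff)
  qed
qed

lemma I_L_star_nonneg_nonzero:
  assumes Y: "kirchhoff_matrix Y" and V_S: "vec_pos V_S"
  shows "0 \<le> I_L_star Y V_S" "I_L_star Y V_S \<noteq> 0"
proof -
  have I: "I_L_star Y V_S $ i = (\<Sum>k\<in>UNIV. - Y_LS Y $ i $ k * V_S $ k)" for i
    by (simp add: I_L_star_def matrix_vector_mult_def sum_negf)
  have nonneg: "0 \<le> - Y_LS Y $ i $ k * V_S $ k" for i k
    using Y_LS_nonpos[OF Y, of i k] V_S
    by (intro mult_nonneg_nonneg) (auto simp: vec_pos_def less_imp_le)
  then show "0 \<le> I_L_star Y V_S"
    by (simp only: less_eq_vec_def I zero_index) (auto intro!: sum_nonneg)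
  obtain i k where "Y_LS Y $ i $ k < 0"
    using Y_LS_neg_entry[OF Y] by blast
  then have "0 < - Y_LS Y $ i $ k * V_S $ k"
    using V_S by (intro mult_pos_pos) (auto simp: vec_pos_def)
  then have "0 < I_L_star Y V_S $ i"
    unfolding I using nonneg by (intro sum_pos2[of _ k]) auto
  then show "I_L_star Y V_S \<noteq> 0"
    by auto
qed

section \<open>Diagonal scaling and feasibility of demands\<close>

lemma matrix_inv_mult_vector:
  fixes A :: "real ^ 'n ^ 'n"
  assumes "invertible A"
  shows "A *v (matrix_inv A *v b) = b"
proof -
  have "A ** matrix_inv A = mat 1"
    using someI_ex[OF assms[unfolded invertible_def]] by (simp add: matrix_inv_def)
  then show ?thesis
    by (simp add: matrix_vector_mul_assoc)
qed

lemma diag_mat_mult: "(diag_mat x *v y) $ i = x $ i * y $ i"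
  by (simp add: diag_mat_def matrix_vector_mult_def if_distrib[of "\<lambda>a. a * _"] cong: if_cong)

lemma invertible_diag_mat:
  assumes "vec_pos x"
  shows "invertible (diag_mat x)"
proof -
  have "y = 0" if "diag_mat x *v y = 0" for y
    using that assms by (auto simp: vec_eq_iff diag_mat_mult vec_pos_def less_imp_neq[symmetric])
  then show ?thesis
    by (auto simp: invertible_left_inverse matrix_left_invertible_ker)
qed

theorem theorem4p5:
  fixes Y :: "real ^ ('n::finite + 'm::finite) ^ ('n + 'm)"
    and V_S :: "real ^ 'm"
    and P :: "real ^ 'n"
  assumes "kirchhoff_matrix Y"
    and "irreducible_mat (Y_LL Y)"
    and "vec_pos V_S"
    and "demand_bound Y V_S P"
  shows "P \<in> feasible_demands Y V_S \<and>
    ((\<nexists>\<alpha>. \<alpha> \<noteq> {} \<and> critical_form Y V_S \<alpha> P) \<longrightarrow> P \<in> interior (feasible_demands Y V_S))"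
proof -
  interpret strong_M_matrix "Y_LL Y"
    by (rule strong_M_matrix_Y_LL[OF assms(1,2)])
  let ?A = "Y_LL Y" and ?v = "V_L_star Y V_S"
  have v: "vec_pos ?v"
    using matrix_inv_mult_vector[OF invertible_A] I_L_star_nonneg_nonzero[OF assms(1,3)]
    unfolding V_L_star_def by (rule solution_pos)
  have vpos: "0 < ?v $ i" for i
    using v by (simp add: vec_pos_def)
  let ?D = "diag_mat ?v"
  define M where "M = (1/4) *\<^sub>R (?D ** ?A ** ?D)"
  define z where "z = matrix_inv M *v vec_max P 0"
  \<comment> \<open>Scaled so that \<open>[v] A y = max(P, 0)\<close>, while the assumed bound
    \<open>z \<le> 1\<close> becomes \<open>4 y \<le> v\<close>.\<close>
  define y where "y = (1/4) *\<^sub>R (?D *v z)"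
  have Mmult: "M *v x = (1/4) *\<^sub>R (?D *v (?A *v (?D *v x)))" for x
    by (simp add: M_def scaleR_matrix_vector_assoc[symmetric] matrix_vector_mul_assoc matrix_mul_assoc)
  have "invertible M"
    unfolding M_def using invertible_diag_mat[OF v] invertible_A
    by (intro scalar_invertible invertible_mult) auto
  then have "M *v z = vec_max P 0"
    unfolding z_def by (rule matrix_inv_mult_vector)
  then have "?D *v (?A *v y) = vec_max P 0"
    by (simp add: Mmult y_def matrix_vector_mult_scaleR)
  then have y: "?v $ i * (?A *v y) $ i = max (P $ i) 0" for i
    by (simp add: vec_eq_iff diag_mat_mult vec_max_def)
  have "z \<le> 1"
    using assms(4) by (simp add: demand_bound_def z_def M_def)
  then have y_le: "4 * y $ i \<le> ?v $ i" for i
    using vpos[of i] by (simp add: y_def diag_mat_mult less_eq_vec_def mult_left_le)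
  have feasible_iff: "Q \<in> feasible_demands Y V_S \<longleftrightarrow>
      (\<exists>V. vec_pos V \<and> (\<forall>i. V $ i * (?A *v (?v - V)) $ i = Q $ i))" for Q
    by (auto simp: feasible_demands_def power_demand_def vec_eq_iff diag_mat_mult eq_commute)
  have "P \<in> feasible_demands Y V_S"
    unfolding feasible_iff
    using subsolution_pos[OF y_le v] subsolution[OF v y y_le] by (rule solution_of_subsolution)
  moreover have "P \<in> interior (feasible_demands Y V_S)"
    if strict: "\<exists>V. vec_pos V \<and> (\<forall>i. P $ i < V $ i * (?A *v (?v - V)) $ i)"
  proof -
    obtain V where V: "vec_pos V" "\<And>i. P $ i < V $ i * (?A *v (?v - V)) $ i"
      using strict by blast
    \<comment> \<open>A strict subsolution for \<open>P\<close> is a subsolution for every demand in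
      this open orthant below the power at \<open>V\<close>.\<close>
    let ?U = "\<Inter>i. {Q :: real ^ 'n. Q $ i < V $ i * (?A *v (?v - V)) $ i}"
    show ?thesis
    proof (rule interiorI)
      show "open ?U"
        by (intro open_INT) (auto intro!: open_Collect_less continuous_intros)
      show "P \<in> ?U"
        using V by simp
      show "?U \<subseteq> feasible_demands Y V_S"
      proof
        fix Q assume "Q \<in> ?U"
        then have "Q $ i \<le> V $ i * (?A *v (?v - V)) $ i" for i
          by (simp add: less_imp_le)
        then show "Q \<in> feasible_demands Y V_S"
          unfolding feasible_iff by (rule solution_of_subsolution[OF V(1)])
      qed
    qed
  qed
  moreover have "\<exists>V. vec_pos V \<and> (\<forall>i. P $ i < V $ i * (?A *v (?v - V)) $ i)"
    if nc: "\<nexists>\<alpha>. \<alpha> \<noteq> {} \<and> critical_form Y V_S \<alpha> P"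
  \<comment> \<open>The support of \<open>P\<close> will be the critical index set, so
    \<open>P = 0\<close>, with empty support, is treated apart.\<close>
  proof (cases "P = 0")
    case True
    then show ?thesis
      using strict_subsolution_zero_demand[OF v] by simp
  next
    case False
    have "\<exists>k. P $ k < 0 \<or> 0 < P $ k \<and> 4 * y $ k < ?v $ k"
    proof (rule ccontr)
      assume ns: "\<not> ?thesis"
      define \<alpha> where "\<alpha> = {i. P $ i \<noteq> 0}"
      have P0: "0 \<le> P $ i" for i
        using ns by (meson not_less)
      have yv: "4 * y $ i = ?v $ i" if "i \<in> \<alpha>" for i
      proof -
        have "0 < P $ i"
          using that P0[of i] by (simp add: \<alpha>_def)
        then have "\<not> 4 * y $ i < ?v $ i"
          using ns by blast
        with y_le[of i] show ?thesis
          by simp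
      qed
      have y': "?v $ i * (?A *v y) $ i = P $ i" for i
        using y P0 by simp
      have "(?A *v y) $ i = 0" if "i \<notin> \<alpha>" for i
        using y'[of i] vpos[of i] that by (auto simp: \<alpha>_def)
      then have "subvec (- \<alpha>) (?A *v y) = 0"
        by (simp add: subvec_def vec_eq_iff)
      then have "schur_complement ?A \<alpha> *v subvec \<alpha> y = subvec \<alpha> (?A *v y)"
        by (rule schur_complement_mult)
      moreover have "subvec \<alpha> ?v = 4 *\<^sub>R subvec \<alpha> y"
        using yv by (simp add: subvec_def vec_eq_iff)
      \<comment> \<open>Since \<open>v\<close> is \<open>4 y\<close> on \<open>\<alpha>\<close>, the
        factor 1/4 of the critical form cancels and \<open>v $ i * (A *v y) $ i = P $ i\<close>
        remains.\<close>
      ultimately have "schur_complement ?A \<alpha> *v subvec \<alpha> ?v = 4 *\<^sub>R subvec \<alpha> (?A *v y)"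
        by (simp add: matrix_vector_mult_scaleR)
      then have "critical_form Y V_S \<alpha> P"
        by (simp add: critical_form_def vec_eq_iff diag_mat_mult subvec_def \<alpha>_def y')
      moreover have "\<alpha> \<noteq> {}"
        using False by (auto simp: \<alpha>_def vec_eq_iff)
      ultimately show False
        using nc by blast
    qed
    then obtain k where "P $ k < 0 \<or> 0 < P $ k \<and> 4 * y $ k < ?v $ k"
      by blast
    then show ?thesis
      by (rule strict_subsolution[OF v y y_le])
  qed
  ultimately show ?thesis
    by blast
qed

end
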